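(* Let $S$ be a stability theory or a monic stability theory. Then for every $n$ there are isomorphisms of digraphs $$Adj(S^{(n)})\cong Adj(S)^{(n)},\qquad Adj(\underline{S^{(n)}})\cong Adj\big((S,\underline{Str(S)})\big)^{(n)}.$$
   Context: A stability theory is $S=(X,\Omega,e)$ with $X=\mathbb{CP}^1$, $e=\infty$; a monic stability theory is $S=(X,\Omega,e)$ with $X=\mathbb C$, $e=0$; in both cases $\Omega\subseteq X$ is semialgebraic ($X$ viewed as a real algebraic variety). $S$ is viewed as $X$ with the stratification $Str(S)$ consisting of (the non-empty ones among) $\Omega_s=\Omega$, $\Omega_{ss}=\overline\Omega\setminus\Omega$, $\Omega_{un}=X\setminus\overline\Omega$ (Euclidean closure in $X$). $X^{(n)}=X^n/\Sigma_n$ is the symmetric product (multisets of cardinality $n$); it is a filtered variety via $\lambda_{n}:X^{(n)}\to X^{(n+1)}$, adding $e$ to a multiset ($X^{(0)}$ is the point $\{e\}$). For a stratification $T$ of $X$, $T^{(n)}$ is the stratification of $X^{(n)}$ by the numbers of points (with multiplicity) in each stratum of $T$; $S^{(n)}$ denotes $X^{(n)}$ with the stratification $Str(S)^{(n)}$. $\underline{S^{(n)}}$ denotes $X^{(n)}$ with the stratification defined inductively: $\underline{S^{(0)}}=S^{(0)}$, and the strata of $\underline{S^{(n+1)}}$ are the non-empty sets $s\setminus\lambda_n(X^{(n)})$ for $s$ a stratum of $S^{(n+1)}$, together with the sets $\lambda_n(t)$ for $t$ a stratum of $\underline{S^{(n)}}$. In particular $\underline{Str(S)}$ is the stratification of $X$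 consisting of the non-empty sets among $\Omega_s\setminus\{e\},\Omega_{ss}\setminus\{e\},\Omega_{un}\setminus\{e\}$ and of $\{e\}$. The adjacency digraph $Adj$ of a finitely stratified space has the strata as vertices and an edge $(A,B)$ iff $\overline A\cap B\ne\varnothing$ (Euclidean closure). For a digraph $G$, $G^n$ has as vertices $n$-tuples of vertices, with an edge iff there is an edge in every component; $G^{(n)}$ is its quotient by $\Sigma_n$: vertices are multisets of $n$ vertices of $G$, with an edge between two multisets iff some orderings of them form an edge of $G^n$. *)

theory Defs
  imports "HOL-Analysis.Analysis" "Graph_Theory.Graph_Theory"
begin

section \<open>Quotient topologies and symmetric products\<close>

definition quotient_topology :: "'a topology \<Rightarrow> ('a \<Rightarrow> 'b) \<Rightarrow> 'b topology" where
  "quotient_topology X q =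
     topology (\<lambda>U. U \<subseteq> q ` topspace X \<and> openin X {x \<in> topspace X. q x \<in> U})"

lemma openin_quotient_topology:
  "openin (quotient_topology X q) U \<longleftrightarrow>
     U \<subseteq> q ` topspace X \<and> openin X {x \<in> topspace X. q x \<in> U}"
proof -
  have "istopology (\<lambda>U. U \<subseteq> q ` topspace X \<and> openin X {x \<in> topspace X. q x \<in> U})"
    unfolding istopology_def
  proof (rule conjI; intro allI impI)
    fix S T
    assume S: "S \<subseteq> q ` topspace X \<and> openin X {x \<in> topspace X. q x \<in> S}"
      and T: "T \<subseteq> q ` topspace X \<and> openin X {x \<in> topspace X. q x \<in> T}"
    have "{x \<in> topspace X. q x \<in> S \<inter> T} =
      {x \<in> topspace X. q x \<in> S} \<inter> {x \<in> topspace X. q x \<in> T}" by auto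
    with S T show "S \<inter> T \<subseteq> q ` topspace X \<and> openin X {x \<in> topspace X. q x \<in> S \<inter> T}"
      by auto
  next
    fix K
    assume K: "\<forall>S\<in>K. S \<subseteq> q ` topspace X \<and> openin X {x \<in> topspace X. q x \<in> S}"
    have "{x \<in> topspace X. q x \<in> \<Union>K} = (\<Union>S\<in>K. {x \<in> topspace X. q x \<in> S})" by auto
    with K show "\<Union>K \<subseteq> q ` topspace X \<and> openin X {x \<in> topspace X. q x \<in> \<Union>K}"
      by auto
  qed
  then show ?thesis
    by (simp add: quotient_topology_def topology_inverse')
qed

lemma topspace_quotient_topology [simp]:
  "topspace (quotient_topology X q) = q ` topspace X"
proof
  show "topspace (quotient_topology X q) \<subseteq> q ` topspace X"
    using openin_topspace[of "quotient_topology X q"]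
    unfolding openin_quotient_topology by (rule conjunct1)
  have "{x \<in> topspace X. q x \<in> q ` topspace X} = topspace X" by auto
  then have "openin (quotient_topology X q) (q ` topspace X)"
    by (simp add: openin_quotient_topology)
  then show "q ` topspace X \<subseteq> topspace (quotient_topology X q)"
    by (rule openin_subset)
qed

lemma quotient_map_quotient_topology: "quotient_map X (quotient_topology X q) q"
  by (auto simp: quotient_map_def openin_quotient_topology)

text \<open>The points of the symmetric product are multisets of size \<open>n\<close>; the point of the
  zeroth one is the empty multiset.\<close>

definition sym_product :: "'a topology \<Rightarrow> nat \<Rightarrow> 'a multiset topology" where
  "sym_product X n =
     quotient_topology (product_topology (\<lambda>_. X) {..<n}) (\<lambda>x. image_mset x (mset_set {..<n}))"

lemma topspace_sym_product:
  "topspace (sym_product X n) = {M. size M = n \<and> set_mset M \<subseteq> topspace X}"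
proof (intro equalityI subsetI)
  fix M assume "M \<in> topspace (sym_product X n)"
  then obtain x where x: "x \<in> (\<Pi>\<^sub>E i\<in>{..<n}. topspace X)"
    and M: "M = image_mset x (mset_set {..<n})"
    unfolding sym_product_def topspace_quotient_topology topspace_product_topology by blast
  have "x i \<in> topspace X" if "i < n" for i
    using PiE_mem[OF x] that by simp
  then show "M \<in> {M. size M = n \<and> set_mset M \<subseteq> topspace X}"
    by (auto simp: M)
next
  fix M assume M: "M \<in> {M. size M = n \<and> set_mset M \<subseteq> topspace X}"
  obtain xs where xs: "mset xs = M" using ex_mset by blast
  let ?x = "restrict (\<lambda>i. xs ! i) {..<n}"
  have len: "length xs = n" using M xs by auto
  have mem: "xs ! i \<in> topspace X" if "i < n" for i
  proof -
    have "xs ! i \<in># M" using nth_mem_mset[of i xs] xs len that by simp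
    then show ?thesis using M by (simp add: subset_iff)
  qed
  have "image_mset ?x (mset_set {..<n}) = image_mset (\<lambda>i. xs ! i) (mset_set {..<n})"
    by (rule image_mset_cong) auto
  also have "\<dots> = mset (map (\<lambda>i. xs ! i) [0..<length xs])"
    by (simp only: mset_map mset_upt len atLeast0LessThan)
  also have "\<dots> = M" by (simp add: map_nth xs)
  finally have "M = image_mset ?x (mset_set {..<n})" by simp
  moreover have "?x \<in> (\<Pi>\<^sub>E i\<in>{..<n}. topspace X)"
    using mem by (intro restrict_PiE_iff[THEN iffD2]) simp
  ultimately show "M \<in> topspace (sym_product X n)"
    unfolding sym_product_def topspace_quotient_topology topspace_product_topology by blast
qed

section \<open>Semialgebraic sets and the complex projective line\<close>

inductive semialgebraic :: "'a::euclidean_space set \<Rightarrow> bool" where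
  pos: "real_polynomial_function p \<Longrightarrow> semialgebraic {x. p x > 0}"
| Compl: "semialgebraic A \<Longrightarrow> semialgebraic (- A)"
| Un: "semialgebraic A \<Longrightarrow> semialgebraic B \<Longrightarrow> semialgebraic (A \<union> B)"

text \<open>A point of the projective line is a complex line through the origin of the plane.\<close>

type_synonym cline = "(complex \<times> complex) set"

definition cline :: "complex \<times> complex \<Rightarrow> cline" where
  "cline v = {(c * fst v, c * snd v) | c. True}"

definition CP1 :: "cline topology" where
  "CP1 = quotient_topology (top_of_set (UNIV - {(0, 0)})) cline"

definition CP1_infinity :: cline where
  "CP1_infinity = cline (1, 0)"

text \<open>For the real algebraic structure of the projective line, being semialgebraic can be
  tested on the two standard affine charts, which form a finite Zariski open cover.\<close>

definition semialgebraic_CP1 :: "cline set \<Rightarrow> bool" where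
  "semialgebraic_CP1 A \<longleftrightarrow> A \<subseteq> topspace CP1 \<and>
     semialgebraic {z. cline (z, 1) \<in> A} \<and> semialgebraic {z. cline (1, z) \<in> A}"

section \<open>Stability theories and their stratifications\<close>

record 'a stability =
  ambient :: "'a topology"
  stable_locus :: "'a set"
  basepoint :: 'a

definition stability_theory :: "cline stability \<Rightarrow> bool" where
  "stability_theory S \<longleftrightarrow>
     ambient S = CP1 \<and> semialgebraic_CP1 (stable_locus S) \<and> basepoint S = CP1_infinity"

definition monic_stability_theory :: "complex stability \<Rightarrow> bool" where
  "monic_stability_theory S \<longleftrightarrow>
     ambient S = euclidean \<and> semialgebraic (stable_locus S) \<and> basepoint S = 0"

definition Str :: "'a stability \<Rightarrow> 'a set set" where
  "Str S =
    {stable_locus S,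
     (ambient S closure_of stable_locus S) - stable_locus S,
     topspace (ambient S) - (ambient S closure_of stable_locus S)} - {{}}"

definition underlined_Str :: "'a stability \<Rightarrow> 'a set set" where
  "underlined_Str S = insert {basepoint S} ((\<lambda>A. A - {basepoint S}) ` Str S - {{}})"

text \<open>A stratum consists of all multisets having a prescribed number \<open>c A\<close> of points,
  counted with multiplicity, in each stratum \<open>A\<close> of \<open>T\<close>.\<close>

definition sym_strata :: "'a topology \<Rightarrow> 'a set set \<Rightarrow> nat \<Rightarrow> 'a multiset set set" where
  "sym_strata X T n =
     {{M \<in> topspace (sym_product X n). \<forall>A\<in>T. size (filter_mset (\<lambda>x. x \<in> A) M) = c A}
       | c. True} - {{}}"

primrec underlined_sym_strata :: "'a stability \<Rightarrow> nat \<Rightarrow> 'a multiset set set" where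
  "underlined_sym_strata S 0 = sym_strata (ambient S) (Str S) 0"
| "underlined_sym_strata S (Suc n) =
     ((\<lambda>s. s - add_mset (basepoint S) ` topspace (sym_product (ambient S) n))
        ` sym_strata (ambient S) (Str S) (Suc n) - {{}})
     \<union> (\<lambda>t. add_mset (basepoint S) ` t) ` underlined_sym_strata S n"

section \<open>Adjacency digraphs and symmetric powers of digraphs\<close>

definition Adj :: "'a topology \<Rightarrow> 'a set set \<Rightarrow> 'a set pair_pre_digraph" where
  "Adj X T =
    \<lparr>pverts = T, parcs = {(A, B). A \<in> T \<and> B \<in> T \<and> (X closure_of A) \<inter> B \<noteq> {}}\<rparr>"

definition digraph_power :: "'a pair_pre_digraph \<Rightarrow> nat \<Rightarrow> 'a list pair_pre_digraph" where
  "digraph_power G n =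
    \<lparr>pverts = {xs. length xs = n \<and> set xs \<subseteq> pverts G},
     parcs = {(xs, ys). length xs = n \<and> length ys = n \<and> (\<forall>i<n. (xs ! i, ys ! i) \<in> parcs G)}\<rparr>"

definition digraph_sym_power :: "'a pair_pre_digraph \<Rightarrow> nat \<Rightarrow> 'a multiset pair_pre_digraph" where
  "digraph_sym_power G n =
    \<lparr>pverts = mset ` pverts (digraph_power G n),
     parcs = (\<lambda>(xs, ys). (mset xs, mset ys)) ` parcs (digraph_power G n)\<rparr>"

end

theory Submission
  imports Defs
begin

text \<open>
  The first isomorphism is a fact about partitions \<open>T\<close> of a topological space \<open>X\<close> into non-empty
  pieces.

  A stratum of the \<open>n\<close>-th symmetric product is given by a multiset \<open>N\<close> of \<open>n\<close> pieces: it consists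
  of the multisets of points which can be matched with \<open>N\<close> so that each point lies in the piece
  matched with it. In terms of the relator of multisets, this is the set of all \<open>M\<close> with
  \<open>rel_mset (\<in>) M N\<close>, and \<open>N\<close> can be recovered from it because the pieces are disjoint and
  non-empty (\<open>sym_strata_eq\<close>, \<open>inj_on_matched\<close>).

  The key fact is that closure commutes with matching (\<open>closure_of_matched\<close>): \<open>M\<close> is in the
  closure of the stratum of \<open>N\<close> iff \<open>M\<close> can be matched with \<open>N\<close> so that each point lies in the
  closure of its piece. Indeed the quotient map from \<open>X\<^sup>n\<close> is open, so the closure can be computed
  upstairs, where the preimage of the stratum is the finite union of the products of the pieces over
  all orderings of \<open>N\<close>, and the closure of a product is the product of the closures.
  Consequently the closure of the stratum of \<open>N\<close> meets the stratum of \<open>N'\<close> iff some \<open>M\<close> is matched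
  with \<open>N\<close> through \<open>x \<in> closure A\<close> and with \<open>N'\<close> through \<open>x \<in> B\<close>. As the relator commutes with
  composition of relations, this says that \<open>N\<close> and \<open>N'\<close> are matched by \<open>closure A \<inter> B \<noteq> {}\<close>, which is
  the adjacency of the symmetric power of the digraph.

  For the underlined stratification, a multiset is separated by the number of copies of the
  basepoint \<open>e\<close> in it, and the rest is stratified as before. Hence it is nothing but the
  stratification of the symmetric product induced by the partition of \<open>X\<close> obtained by splitting \<open>e\<close>
  off (\<open>underlined_sym_strata_eq_sym_strata\<close>), and the first isomorphism applies to that partition.
\<close>

section \<open>Matchings of indexed families\<close>

text \<open>In \<open>rel_mset_induct\<close> the relation varies along with the multisets. Fixing it lets the induction
  start from a premise about a concrete relation.\<close>

lemma matching_induct [consumes 1, case_names empty add]: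
  assumes "rel_mset R M N" and "P {#} {#}"
    and "\<And>a b M N. R a b \<Longrightarrow> rel_mset R M N \<Longrightarrow> P M N \<Longrightarrow> P (add_mset a M) (add_mset b N)"
  shows "P M N"
  using assms by (induction R M N rule: rel_mset_induct) auto

lemma obtain_mset_as_image:
  assumes "size N = n"
  obtains a where "N = image_mset a (mset_set {..<n})"
proof -
  obtain xs where xs: "mset xs = N" using ex_mset by blast
  then have "length xs = n" using assms by auto
  then have "N = image_mset (\<lambda>i. xs ! i) (mset_set {..<n})"
    by (metis atLeast0LessThan map_nth mset_map mset_upt xs)
  then show thesis by (rule that)
qed

text \<open>The coordinates of a point of \<open>X\<^sup>n\<close> and an enumeration of the pieces fix the indexing on both
  sides, so a matching is the choice of a permutation.\<close>

lemma rel_mset_image_image_iff_permutes: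
  fixes n :: nat
  shows "rel_mset R (image_mset x (mset_set {..<n})) (image_mset a (mset_set {..<n})) \<longleftrightarrow>
     (\<exists>p. p permutes {..<n} \<and> (\<forall>i<n. R (x i) (a (p i))))"
    (is "?L \<longleftrightarrow> ?R")
proof
  assume ?L
  then obtain Z where Z: "set_mset Z \<subseteq> {(u, v). R u v}"
      "image_mset fst Z = image_mset x (mset_set {..<n})"
      "image_mset snd Z = image_mset a (mset_set {..<n})"
    unfolding multiset.in_rel by blast
  (* Z is a multiset of matched pairs; enumerating it as z, the permutation p moves x to the
     first components of z and p' moves the second components to a. *)
  have "size Z = n" using arg_cong[OF Z(2), of size] by simp
  then obtain z where z: "Z = image_mset z (mset_set {..<n})"
    by (rule obtain_mset_as_image)
  have "image_mset x (mset_set {..<n}) = image_mset (\<lambda>i. fst (z i)) (mset_set {..<n})"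
    using Z(2) by (simp add: z image_mset.compositionality comp_def)
  then obtain p where p: "p permutes {..<n}" "\<forall>i\<in>{..<n}. x i = fst (z (p i))"
    by (rule image_mset_eq_implies_permutes[rotated]) simp_all
  have "image_mset (\<lambda>i. snd (z i)) (mset_set {..<n}) = image_mset a (mset_set {..<n})"
    using Z(3) by (simp add: z image_mset.compositionality comp_def)
  then obtain p' where p': "p' permutes {..<n}" "\<forall>i\<in>{..<n}. snd (z i) = a (p' i)"
    by (rule image_mset_eq_implies_permutes[rotated]) simp_all
  have "R (x i) (a ((p' \<circ> p) i))" if "i < n" for i
  proof -
    have "p i < n" using permutes_in_image[OF p(1)] that by auto
    then have "z (p i) \<in># Z" by (simp add: z)
    then have "R (fst (z (p i))) (snd (z (p i)))" using Z(1) by (auto simp: subset_iff split_beta)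
    then show ?thesis using p(2) p'(2) that \<open>p i < n\<close> by simp
  qed
  moreover have "(p' \<circ> p) permutes {..<n}" using p(1) p'(1) by (rule permutes_compose)
  ultimately show ?R by blast
next
  assume ?R
  then obtain p where p: "p permutes {..<n}" and R: "\<forall>i<n. R (x i) (a (p i))" by blast
  have "image_mset a (mset_set {..<n}) = image_mset (\<lambda>i. a (p i)) (mset_set {..<n})"
    by (rule permutes_implies_image_mset_eq[OF p]) simp
  then show ?L
    using R by (auto simp: multiset.rel_map intro: multiset.rel_refl_strong)
qed

section \<open>Closures in the symmetric product\<close>

text \<open>Saturating an open set \<open>U\<close> of \<open>X\<^sup>n\<close> gives the union of its translates under the symmetric
  group, which acts by homeomorphisms.\<close>

lemma open_map_sym_product:
  "open_map (product_topology (\<lambda>_. X) {..<n}) (sym_product X n)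
     (\<lambda>x. image_mset x (mset_set {..<n}))"
  unfolding open_map_def
proof (intro allI impI)
  let ?P = "product_topology (\<lambda>_. X) {..<n}" and ?q = "\<lambda>x. image_mset x (mset_set {..<n})"
  let ?act = "\<lambda>p x. restrict (\<lambda>i. x (p i)) {..<n}"
  fix U assume U: "openin ?P U"
  have act: "continuous_map ?P ?P (?act p)" if p: "p permutes {..<n}" for p
  proof (rule continuous_map_coordinatewise_then_product)
    fix i assume "i \<in> {..<n}"
    then have "p i \<in> {..<n}" using permutes_in_image[OF p] by auto
    then have "continuous_map ?P X (\<lambda>x. x (p i))"
      by (rule continuous_map_product_projection)
    then show "continuous_map ?P X (\<lambda>x. ?act p x i)"
      using \<open>i \<in> {..<n}\<close> by simp
  qed simp
  have sat: "{x \<in> topspace ?P. ?q x \<in> ?q ` U} =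
      (\<Union>p\<in>{p. p permutes {..<n}}. {x \<in> topspace ?P. ?act p x \<in> U})"
  proof (intro equalityI subsetI)
    fix x assume "x \<in> {x \<in> topspace ?P. ?q x \<in> ?q ` U}"
    then obtain u where x: "x \<in> topspace ?P" and u: "u \<in> U" and "?q u = ?q x" by auto
    from this(3) obtain p where p: "p permutes {..<n}" "\<forall>i\<in>{..<n}. u i = x (p i)"
      by (rule image_mset_eq_implies_permutes[rotated]) simp_all
    have "u \<in> extensional {..<n}"
      using u openin_subset[OF U] by (auto simp: PiE_iff)
    then have "?act p x = u"
      using p(2) by (intro extensionalityI[of _ "{..<n}"]) auto
    then show "x \<in> (\<Union>p\<in>{p. p permutes {..<n}}. {x \<in> topspace ?P. ?act p x \<in> U})"
      using x u p(1) by auto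
  next
    fix x assume "x \<in> (\<Union>p\<in>{p. p permutes {..<n}}. {x \<in> topspace ?P. ?act p x \<in> U})"
    then obtain p where p: "p permutes {..<n}" and x: "x \<in> topspace ?P" and U: "?act p x \<in> U"
      by auto
    have "?q (?act p x) = ?q x"
      by (rule permutes_implies_image_mset_eq[OF p, symmetric]) simp
    then show "x \<in> {x \<in> topspace ?P. ?q x \<in> ?q ` U}"
      using x U by (metis (mono_tags, lifting) imageI mem_Collect_eq)
  qed
  have "openin ?P {x \<in> topspace ?P. ?q x \<in> ?q ` U}"
    unfolding sat using openin_continuous_map_preimage[OF act U]
    by (intro openin_Union ballI) blast
  then show "openin (sym_product X n) (?q ` U)"
    unfolding sym_product_def openin_quotient_topology using openin_subset[OF U] by blast
qed

lemma matched_in_sym_product: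
  assumes "size N = n" and "\<And>A. A \<in># N \<Longrightarrow> F A \<subseteq> topspace X"
    and "rel_mset (\<lambda>x A. x \<in> F A) M N"
  shows "M \<in> topspace (sym_product X n)"
proof -
  have "\<exists>A\<in>set_mset N. x \<in> F A" if "x \<in># M" for x
    using assms(3) that
  proof (induction rule: matching_induct)
    case (add a b M N)
    then show ?case by auto
  qed simp
  then show ?thesis
    using assms rel_mset_size[OF assms(3)] by (fastforce simp: topspace_sym_product)
qed

text \<open>Since the quotient map is open, a point \<open>q b\<close> is in the closure of a set iff \<open>b\<close> is in the
  closure of its preimage. The preimage here is a finite union of products, one for each ordering of
  \<open>N\<close>, and closure commutes with both operations.\<close>

lemma closure_of_matched:
  assumes n: "size N = n" and sub: "\<And>A. A \<in># N \<Longrightarrow> A \<subseteq> topspace X"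
  shows "sym_product X n closure_of {M. rel_mset (\<in>) M N} =
    {M. rel_mset (\<lambda>x A. x \<in> X closure_of A) M N}"
proof -
  let ?P = "product_topology (\<lambda>_. X) {..<n}" and ?q = "\<lambda>x. image_mset x (mset_set {..<n})"
  obtain a where a: "N = ?q a" using n by (rule obtain_mset_as_image)
  let ?box = "\<lambda>p. \<Pi>\<^sub>E i\<in>{..<n}. a (p i)"
  have a_sub: "a (p i) \<subseteq> topspace X" if "p permutes {..<n}" "i < n" for p i
    using sub permutes_in_image[OF that(1), of i] that(2) by (auto simp: a)
  have box_sub: "?box p \<subseteq> topspace ?P" if "p permutes {..<n}" for p
    using a_sub[OF that] by (auto simp: PiE_iff)
  have cl_box: "?P closure_of ?box p = (\<Pi>\<^sub>E i\<in>{..<n}. X closure_of a (p i))" for p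
    by (rule closure_of_product_topology)
  show ?thesis
  proof (intro equalityI subsetI CollectI)
    fix M assume M: "M \<in> sym_product X n closure_of {M. rel_mset (\<in>) M N}"
    then have "M \<in> topspace (sym_product X n)" by (simp add: in_closure_of)
    then obtain b where b: "b \<in> topspace ?P" "M = ?q b"
      unfolding sym_product_def topspace_quotient_topology by blast
    have "b \<in> ?P closure_of (\<Union>p\<in>{p. p permutes {..<n}}. ?box p)"
      unfolding in_closure_of
    proof (intro conjI allI impI)
      fix U assume U: "b \<in> U \<and> openin ?P U"
      then have "openin (sym_product X n) (?q ` U)" "M \<in> ?q ` U"
        using open_map_sym_product b unfolding open_map_def by blast+
      then have "\<exists>M'. M' \<in> {M. rel_mset (\<in>) M N} \<and> M' \<in> ?q ` U"
        using M unfolding in_closure_of by (elim conjE allE[of _ "?q ` U"]) simp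
      then obtain u where u: "u \<in> U" "rel_mset (\<in>) (?q u) N" by auto
      then obtain p where "p permutes {..<n}" "\<forall>i<n. u i \<in> a (p i)"
        unfolding a rel_mset_image_image_iff_permutes by blast
      moreover have "u \<in> extensional {..<n}"
        using u(1) U openin_subset[of ?P U] by (auto simp: PiE_iff)
      ultimately show "\<exists>y. y \<in> (\<Union>p\<in>{p. p permutes {..<n}}. ?box p) \<and> y \<in> U"
        using u(1) by (auto simp: PiE_iff)
    qed (rule b(1))
    then have "b \<in> (\<Union>p\<in>{p. p permutes {..<n}}. ?P closure_of ?box p)"
      by (subst (asm) closure_of_Union) (auto simp: finite_permutations)
    then show "rel_mset (\<lambda>x A. x \<in> X closure_of A) M N"
      unfolding b(2) a rel_mset_image_image_iff_permutes by (auto simp: cl_box PiE_iff)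
  next
    fix M assume "M \<in> {M. rel_mset (\<lambda>x A. x \<in> X closure_of A) M N}"
    then have M: "rel_mset (\<lambda>x A. x \<in> X closure_of A) M N" by simp
    then have "M \<in> topspace (sym_product X n)"
      using closure_of_subset_topspace by (rule matched_in_sym_product[OF n, rotated])
    then obtain b where b: "b \<in> topspace ?P" "M = ?q b"
      unfolding sym_product_def topspace_quotient_topology by blast
    obtain p where p: "p permutes {..<n}" "\<forall>i<n. b i \<in> X closure_of a (p i)"
      using M unfolding b(2) a rel_mset_image_image_iff_permutes by blast
    have "b \<in> ?P closure_of ?box p"
      using b(1) p(2) by (auto simp: cl_box PiE_iff)
    moreover have "continuous_map ?P (sym_product X n) ?q"
      unfolding sym_product_def by (intro quotient_imp_continuous_map quotient_map_quotient_topology)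
    ultimately have "M \<in> sym_product X n closure_of (?q ` ?box p)"
      using continuous_map_image_closure_subset b(2) by blast
    moreover have "?q ` ?box p \<subseteq> {M. rel_mset (\<in>) M N}"
    proof (intro subsetI CollectI, elim imageE)
      fix M u assume "M = ?q u" "u \<in> ?box p"
      then show "rel_mset (\<in>) M N"
        unfolding a using p(1) by (auto simp: rel_mset_image_image_iff_permutes PiE_iff)
    qed
    ultimately show "M \<in> sym_product X n closure_of {M. rel_mset (\<in>) M N}"
      using closure_of_mono by blast
  qed
qed

section \<open>Strata of the symmetric product\<close>

text \<open>As the pieces are disjoint, a point lies in \<open>A\<close> only if it is matched with a copy of \<open>A\<close>.
  This identifies the counting description of a stratum with the one by matchings.\<close>

lemma count_eq_size_filter_if_matched:
  assumes P: "partition_on Y T" and A: "A \<in> T"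
    and M: "rel_mset (\<in>) M N" and N: "set_mset N \<subseteq> T"
  shows "count N A = size (filter_mset (\<lambda>x. x \<in> A) M)"
  using M N
proof (induction rule: matching_induct)
  case (add x B M N)
  then have "B \<in> T" "x \<in> B" by auto
  then have "x \<in> A \<longleftrightarrow> B = A"
    using partition_onD2[OF P] A by (auto simp: disjoint_def)
  then show ?case using add by auto
qed simp

lemma ex_matched_pieces:
  assumes P: "partition_on Y T" and M: "set_mset M \<subseteq> Y"
  obtains N where "size N = size M" "set_mset N \<subseteq> T" "rel_mset (\<in>) M N"
proof -
  have "\<forall>x\<in>Y. \<exists>A. A \<in> T \<and> x \<in> A" using partition_onD1[OF P] by auto
  then obtain f where f: "\<And>x. x \<in> Y \<Longrightarrow> f x \<in> T \<and> x \<in> f x" by metis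
  have "rel_mset (\<in>) M (image_mset f M)"
    unfolding multiset.rel_map using f M by (intro multiset.rel_refl_strong) auto
  moreover have "set_mset (image_mset f M) \<subseteq> T" using f M by auto
  ultimately show thesis by (intro that[of "image_mset f M"]) auto
qed

lemma ex_matched_points:
  assumes "{} \<notin># N"
  shows "\<exists>M. rel_mset (\<in>) M N"
proof -
  have "rel_mset (\<in>) (image_mset (\<lambda>A. SOME x. x \<in> A) N) N"
    unfolding multiset.rel_map using assms
    by (intro multiset.rel_refl_strong) (metis some_in_eq)
  then show ?thesis ..
qed

lemma multiset_eqI_on:
  assumes N: "set_mset N \<subseteq> T" and N': "set_mset N' \<subseteq> T"
    and eq: "\<And>A. A \<in> T \<Longrightarrow> count N A = count N' A"
  shows "N = N'"
proof (rule multiset_eqI)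
  fix A show "count N A = count N' A"
    using eq[of A] N N' by (cases "A \<in> T") (metis count_inI subset_iff)+
qed

lemma inj_on_matched:
  assumes P: "partition_on Y T"
  shows "inj_on (\<lambda>N. {M. rel_mset (\<in>) M N}) {N. set_mset N \<subseteq> T}"
proof (rule inj_onI)
  fix N N'
  assume N: "N \<in> {N. set_mset N \<subseteq> T}" and N': "N' \<in> {N. set_mset N \<subseteq> T}"
    and eq: "{M. rel_mset (\<in>) M N} = {M. rel_mset (\<in>) M N'}"
  have "{} \<notin># N" using N partition_onD3[OF P] by auto
  then obtain M where M: "rel_mset (\<in>) M N" using ex_matched_points by blast
  then have M': "rel_mset (\<in>) M N'" using eq by blast
  show "N = N'"
    using N N' count_eq_size_filter_if_matched[OF P _ M] count_eq_size_filter_if_matched[OF P _ M']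
    by (intro multiset_eqI_on) auto
qed

lemma sym_strata_eq:
  assumes P: "partition_on (topspace X) T"
  shows "sym_strata X T n =
    (\<lambda>N. {M. rel_mset (\<in>) M N}) ` {N. size N = n \<and> set_mset N \<subseteq> T}"
proof -
  let ?S = "\<lambda>c. {M \<in> topspace (sym_product X n).
    \<forall>A\<in>T. size (filter_mset (\<lambda>x. x \<in> A) M) = c A}"
  have sub: "A \<subseteq> topspace X" if "A \<in> T" for A using partition_onD1[OF P] that by auto
  have eq: "?S (count N) = {M. rel_mset (\<in>) M N}" if N: "size N = n" "set_mset N \<subseteq> T" for N
  proof (intro equalityI subsetI CollectI)
    fix M assume M: "M \<in> ?S (count N)"
    then have "set_mset M \<subseteq> topspace X" by (simp add: topspace_sym_product)
    then obtain N' where N': "set_mset N' \<subseteq> T" "rel_mset (\<in>) M N'"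
      by (rule ex_matched_pieces[OF P])
    have "N' = N"
      using M count_eq_size_filter_if_matched[OF P _ N'(2,1)]
      by (intro multiset_eqI_on[OF N'(1) N(2)]) auto
    then show "rel_mset (\<in>) M N" using N'(2) by simp
  next
    fix M assume "M \<in> {M. rel_mset (\<in>) M N}"
    then have M: "rel_mset (\<in>) M N" by simp
    have "M \<in> topspace (sym_product X n)"
      using N sub M by (intro matched_in_sym_product[of N n "\<lambda>A. A"]) auto
    then show "M \<in> topspace (sym_product X n) \<and>
        (\<forall>A\<in>T. size (filter_mset (\<lambda>x. x \<in> A) M) = count N A)"
      using count_eq_size_filter_if_matched[OF P _ M N(2)] by simp
  qed
  show ?thesis
  proof (intro equalityI subsetI)
    fix s assume "s \<in> sym_strata X T n"
    then obtain c where c: "s = ?S c" "s \<noteq> {}" unfolding sym_strata_def by blast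
    then obtain M where M: "M \<in> ?S c" by blast
    then have "size M = n" "set_mset M \<subseteq> topspace X" by (simp_all add: topspace_sym_product)
    then obtain N where N: "size N = n" "set_mset N \<subseteq> T" "rel_mset (\<in>) M N"
      using ex_matched_pieces[OF P] by metis
    have "count N A = c A" if "A \<in> T" for A
      using count_eq_size_filter_if_matched[OF P that N(3,2)] M that by simp
    then have "s = ?S (count N)" unfolding c(1) by auto
    then show "s \<in> (\<lambda>N. {M. rel_mset (\<in>) M N}) ` {N. size N = n \<and> set_mset N \<subseteq> T}"
      using eq N by blast
  next
    fix s assume "s \<in> (\<lambda>N. {M. rel_mset (\<in>) M N}) ` {N. size N = n \<and> set_mset N \<subseteq> T}"
    then obtain N where N: "size N = n" "set_mset N \<subseteq> T" "s = {M. rel_mset (\<in>) M N}" by blast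
    have "{} \<notin># N" using N(2) partition_onD3[OF P] by auto
    then have "s \<noteq> {}" using ex_matched_points N(3) by blast
    moreover have "s = ?S (count N)" using eq N by simp
    ultimately show "s \<in> sym_strata X T n" unfolding sym_strata_def by blast
  qed
qed

section \<open>The adjacency digraph of the symmetric product\<close>

lemma pverts_digraph_sym_power:
  "pverts (digraph_sym_power G n) = {N. size N = n \<and> set_mset N \<subseteq> pverts G}"
proof (intro equalityI subsetI)
  fix N assume N: "N \<in> {N. size N = n \<and> set_mset N \<subseteq> pverts G}"
  obtain xs where "mset xs = N" using ex_mset by blast
  then show "N \<in> pverts (digraph_sym_power G n)"
    using N by (auto simp: digraph_sym_power_def digraph_power_def)
qed (auto simp: digraph_sym_power_def digraph_power_def)

lemma parcs_digraph_sym_power: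
  "parcs (digraph_sym_power G n) =
     {(N, N'). size N = n \<and> rel_mset (\<lambda>A B. (A, B) \<in> parcs G) N N'}"
proof -
  have "(N, N') \<in> parcs (digraph_sym_power G n) \<longleftrightarrow>
      size N = n \<and> rel_mset (\<lambda>A B. (A, B) \<in> parcs G) N N'" for N N'
  proof -
    have "(N, N') \<in> parcs (digraph_sym_power G n) \<longleftrightarrow> (\<exists>xs ys. mset xs = N \<and> mset ys = N' \<and>
        length xs = n \<and> list_all2 (\<lambda>A B. (A, B) \<in> parcs G) xs ys)"
      by (auto simp: digraph_sym_power_def digraph_power_def list_all2_conv_all_nth image_iff)
        metis+
    then show ?thesis unfolding rel_mset_def by (metis size_mset)
  qed
  then show ?thesis by auto
qed

text \<open>A common point of the closure of one stratum and of another one is a multiset of points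
  through which the two multisets of pieces are matched, so the claim is an instance of the
  compatibility of \<open>rel_mset\<close> with relational composition.\<close>

lemma closure_matched_meets_iff:
  assumes n: "size N = n" and sub: "\<And>A. A \<in># N \<Longrightarrow> A \<subseteq> topspace X"
  shows "sym_product X n closure_of {M. rel_mset (\<in>) M N} \<inter> {M. rel_mset (\<in>) M N'} \<noteq> {} \<longleftrightarrow>
    rel_mset (\<lambda>A B. X closure_of A \<inter> B \<noteq> {}) N N'"
proof -
  let ?C = "\<lambda>x A. x \<in> X closure_of A"
  have "sym_product X n closure_of {M. rel_mset (\<in>) M N} \<inter> {M. rel_mset (\<in>) M N'} \<noteq> {} \<longleftrightarrow>
      (\<exists>M. rel_mset ?C M N \<and> rel_mset (\<in>) M N')"
    by (subst closure_of_matched[OF n sub]) auto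
  also have "\<dots> \<longleftrightarrow> ((rel_mset ?C)\<inverse>\<inverse> OO rel_mset (\<in>)) N N'"
    by (auto simp: OO_def)
  also have "\<dots> \<longleftrightarrow> rel_mset (?C\<inverse>\<inverse> OO (\<in>)) N N'"
    by (simp add: multiset.rel_compp multiset.rel_conversep)
  also have "?C\<inverse>\<inverse> OO (\<in>) = (\<lambda>A B. X closure_of A \<inter> B \<noteq> {})"
    by (auto simp: OO_def fun_eq_iff)
  finally show ?thesis .
qed

lemma digraph_iso_with_projI:
  assumes "parcs G \<subseteq> pverts G \<times> pverts G" and inj: "inj_on f (pverts G)"
    and "pverts H = f ` pverts G" and "parcs H = map_prod f f ` parcs G"
  shows "digraph_iso (with_proj G) (with_proj H)"
proof -
  let ?h = "\<lparr>iso_verts = f, iso_arcs = map_prod f f, iso_head = snd, iso_tail = fst\<rparr>"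
  have "inj_on (map_prod f f) (parcs G)"
    using map_prod_inj_on[OF inj inj] assms(1) by (rule inj_on_subset)
  moreover have "wf_digraph (with_proj G)"
    using assms(1) by unfold_locales auto
  ultimately have "pre_digraph.digraph_isomorphism (with_proj G) ?h"
    using inj by (simp add: pre_digraph.digraph_isomorphism_def)
  moreover have "with_proj H = app_iso ?h (with_proj G)"
    using assms(3,4) by (simp add: with_proj_def app_iso_def)
  ultimately show ?thesis unfolding digraph_iso_def by blast
qed

text \<open>The isomorphism is constructed from the symmetric power to the adjacency digraph, where it
  is the explicit map sending \<open>N\<close> to its stratum, and then inverted.\<close>

lemma digraph_iso_Adj_sym_strata:
  assumes P: "partition_on (topspace X) T"
  shows "digraph_iso (with_proj (Adj (sym_product X n) (sym_strata X T n)))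
    (with_proj (digraph_sym_power (Adj X T) n))"
proof -
  let ?G = "digraph_sym_power (Adj X T) n" and ?H = "Adj (sym_product X n) (sym_strata X T n)"
  let ?f = "\<lambda>N. {M. rel_mset (\<in>) M N}"
  let ?V = "{N. size N = n \<and> set_mset N \<subseteq> T}"
  have V: "pverts ?G = ?V"
    by (simp add: pverts_digraph_sym_power Adj_def)
  have E: "(N, N') \<in> parcs ?G \<longleftrightarrow>
      N \<in> ?V \<and> N' \<in> ?V \<and> sym_product X n closure_of ?f N \<inter> ?f N' \<noteq> {}" for N N'
  proof -
    have *: "rel_mset (\<lambda>A B. A \<in> T \<and> B \<in> T \<and> X closure_of A \<inter> B \<noteq> {}) N N' \<longleftrightarrow>
        set_mset N \<subseteq> T \<and> set_mset N' \<subseteq> T \<and> rel_mset (\<lambda>A B. X closure_of A \<inter> B \<noteq> {}) N N'"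
      (is "?l \<longleftrightarrow> ?r")
    proof
      assume ?l
      then show ?r
        by (induction rule: matching_induct) (auto intro: rel_mset_Plus)
    next
      assume ?r
      then have "rel_mset (\<lambda>A B. X closure_of A \<inter> B \<noteq> {}) N N'"
          "set_mset N \<subseteq> T" "set_mset N' \<subseteq> T" by auto
      then show ?l
        by (induction rule: matching_induct) (auto intro: rel_mset_Plus)
    qed
    have sub: "A \<subseteq> topspace X" if "A \<in># N" "N \<in> ?V" for A
      using partition_onD1[OF P] that by auto
    show ?thesis
      unfolding parcs_digraph_sym_power
      using closure_matched_meets_iff[of N n X N'] sub
      by (auto simp: Adj_def * dest: rel_mset_size)
  qed
  have inj: "inj_on ?f ?V"
    using inj_on_matched[OF P] by (rule inj_on_subset) auto
  have "digraph_iso (with_proj ?G) (with_proj ?H)"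
  proof (rule digraph_iso_with_projI)
    show "parcs ?G \<subseteq> pverts ?G \<times> pverts ?G" unfolding V using E by auto
    show "inj_on ?f (pverts ?G)" unfolding V by (rule inj)
    show "pverts ?H = ?f ` pverts ?G"
      unfolding V by (simp add: Adj_def sym_strata_eq[OF P])
    show "parcs ?H = map_prod ?f ?f ` parcs ?G"
    proof (intro equalityI subsetI)
      fix e assume "e \<in> parcs ?H"
      then obtain N N' where e: "e = (?f N, ?f N')" and "N \<in> ?V" "N' \<in> ?V"
          "sym_product X n closure_of ?f N \<inter> ?f N' \<noteq> {}"
        by (auto simp: Adj_def sym_strata_eq[OF P])
      then have "(N, N') \<in> parcs ?G" unfolding E by blast
      then have "map_prod ?f ?f (N, N') \<in> map_prod ?f ?f ` parcs ?G" by (rule imageI)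
      then show "e \<in> map_prod ?f ?f ` parcs ?G" by (simp add: e)
    next
      fix e assume "e \<in> map_prod ?f ?f ` parcs ?G"
      then obtain N N' where e: "e = (?f N, ?f N')" and "(N, N') \<in> parcs ?G" by auto
      from this(2) show "e \<in> parcs ?H"
        unfolding E e by (auto simp: Adj_def sym_strata_eq[OF P])
    qed
  qed
  moreover have "wf_digraph (with_proj ?G)"
    using E by unfold_locales (auto simp: V)
  ultimately show ?thesis by (rule digraph_iso_swap[rotated])
qed

section \<open>Splitting off the basepoint\<close>

lemma partition_on_Str:
  assumes "stable_locus S \<subseteq> topspace (ambient S)"
  shows "partition_on (topspace (ambient S)) (Str S)"
proof -
  let ?X = "topspace (ambient S)" and ?A = "stable_locus S"
  let ?C = "ambient S closure_of ?A"
  have AC: "?A \<subseteq> ?C" using assms by (rule closure_of_subset)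
  have CX: "?C \<subseteq> ?X" by (rule closure_of_subset_topspace)
  show ?thesis
    unfolding Str_def
  proof (rule partition_onI)
    have "\<Union>({?A, ?C - ?A, ?X - ?C} - {{}}) = ?A \<union> (?C - ?A) \<union> (?X - ?C)" by blast
    also have "\<dots> = ?X" using AC CX by blast
    finally show "\<Union>({?A, ?C - ?A, ?X - ?C} - {{}}) = ?X" .
  next
    fix p q
    assume "p \<in> {?A, ?C - ?A, ?X - ?C} - {{}}" "q \<in> {?A, ?C - ?A, ?X - ?C} - {{}}" "p \<noteq> q"
    then consider "p = ?A" "q = ?C - ?A" | "p = ?A" "q = ?X - ?C" | "p = ?C - ?A" "q = ?X - ?C"
      | "q = ?A" "p = ?C - ?A" | "q = ?A" "p = ?X - ?C" | "q = ?C - ?A" "p = ?X - ?C"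
      by (elim DiffE insertE emptyE) simp_all
    then show "disjnt p q" using AC by cases (auto simp: disjnt_def)
  qed simp
qed

lemma partition_on_underlined_Str:
  assumes P: "partition_on (topspace (ambient S)) (Str S)"
    and e: "basepoint S \<in> topspace (ambient S)"
  shows "partition_on (topspace (ambient S)) (underlined_Str S)"
proof -
  let ?e = "basepoint S" and ?X = "topspace (ambient S)"
  let ?T = "(\<lambda>A. A - {?e}) ` Str S - {{}}"
  have "partition_on (?X - {?e}) ?T"
    by (rule partition_on_transform[OF P]) (auto simp: disjnt_def)
  moreover have "disjnt {?e} (\<Union>?T)" by (auto simp: disjnt_def)
  ultimately show ?thesis
    unfolding underlined_Str_def using e partition_on_insert[of "{?e}" ?T ?X] by blast
qed

lemma matched_without_point:
  "{M. rel_mset (\<in>) M N \<and> e \<notin># M} = {M. rel_mset (\<in>) M (image_mset (\<lambda>A. A - {e}) N)}"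
proof -
  have "rel_mset (\<lambda>x A. x \<in> A - {e}) M N" if "rel_mset (\<in>) M N" "e \<notin># M" for M
    using that by (induction rule: matching_induct) (auto intro: rel_mset_Plus)
  moreover have "rel_mset (\<in>) M N \<and> e \<notin># M" if "rel_mset (\<lambda>x A. x \<in> A - {e}) M N" for M
    using that by (induction rule: matching_induct) (auto intro: rel_mset_Plus)
  ultimately show ?thesis by (auto simp: multiset.rel_map)
qed

lemma matched_add_singleton:
  "{M. rel_mset (\<in>) M (add_mset {e} N)} = add_mset e ` {M. rel_mset (\<in>) M N}"
proof (intro equalityI subsetI)
  fix M assume "M \<in> {M. rel_mset (\<in>) M (add_mset {e} N)}"
  then obtain M' x where "M = add_mset x M'" "x \<in> {e}" "rel_mset (\<in>) M' N"
    using msed_rel_invR[of "(\<in>)" M "{e}" N] by auto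
  then show "M \<in> add_mset e ` {M. rel_mset (\<in>) M N}" by simp
next
  fix M assume "M \<in> add_mset e ` {M. rel_mset (\<in>) M N}"
  then obtain M' where "M = add_mset e M'" "rel_mset (\<in>) M' N" by auto
  then show "M \<in> {M. rel_mset (\<in>) M (add_mset {e} N)}"
    using rel_mset_Plus[of "(\<in>)" e "{e}"] by simp
qed

lemma matched_empty_piece:
  assumes "{} \<in># N"
  shows "{M. rel_mset (\<in>) M N} = {}"
proof -
  obtain N' where "N = add_mset {} N'" using assms by (rule mset_add)
  then show ?thesis by (auto dest!: msed_rel_invR)
qed

lemma multiset_in_imageE:
  assumes "set_mset N \<subseteq> f ` T"
  obtains N' where "set_mset N' \<subseteq> T" "N = image_mset f N'"
proof -
  let ?N' = "image_mset (inv_into T f) N"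
  have "image_mset f ?N' = image_mset (\<lambda>x. x) N"
    unfolding image_mset.compositionality using assms
    by (intro image_mset_cong) (auto simp: f_inv_into_f)
  moreover have "set_mset ?N' \<subseteq> T"
    using assms by (auto intro: inv_into_into)
  ultimately show thesis by (intro that[of ?N']) auto
qed

text \<open>Multisets of pieces of the split partition either avoid \<open>{e}\<close>, which gives the multisets of
  points avoiding \<open>e\<close>, or contain it, which gives the multisets obtained by adding \<open>e\<close>.
  If \<open>{e}\<close> is itself a stratum of \<open>S\<close>, removing \<open>e\<close> makes it empty; the strata of the symmetric
  product that use it then become empty as well and are discarded, just as the empty piece is
  discarded from the split partition.\<close>

lemma underlined_sym_strata_eq_sym_strata:
  assumes P: "partition_on (topspace (ambient S)) (Str S)"
    and e: "basepoint S \<in> topspace (ambient S)"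
  shows "underlined_sym_strata S n = sym_strata (ambient S) (underlined_Str S) n"
proof (induction n)
  case 0
  have zero: "{N. size N = 0 \<and> set_mset N \<subseteq> T} = {{#}}" for T :: "'a set set" by auto
  show ?case
    by (simp only: underlined_sym_strata.simps sym_strata_eq[OF P]
        sym_strata_eq[OF partition_on_underlined_Str[OF P e]] zero)
next
  case (Suc n)
  let ?e = "basepoint S" and ?X = "ambient S" and ?T = "Str S"
  let ?T' = "underlined_Str S" and ?f = "\<lambda>N. {M. rel_mset (\<in>) M N}"
  let ?R = "(\<lambda>A. A - {?e}) ` ?T - {{}}"
  let ?W = "\<lambda>T m. {N. size N = m \<and> set_mset N \<subseteq> T}"
  have T': "?T' = insert {?e} ?R" by (simp add: underlined_Str_def)
  (* A member of the stratum of N has n + 1 points, so it arises by adding e iff it contains e. *)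
  have minus: "?f N - add_mset ?e ` topspace (sym_product ?X n) =
      ?f (image_mset (\<lambda>A. A - {?e}) N)" if "N \<in> ?W ?T (Suc n)" for N
  proof -
    have "M \<in> topspace (sym_product ?X (Suc n))" if "rel_mset (\<in>) M N" for M
      using that \<open>N \<in> ?W ?T (Suc n)\<close> partition_onD1[OF P]
      by (intro matched_in_sym_product[of N "Suc n" "\<lambda>A. A"]) auto
    then have "M \<in> add_mset ?e ` topspace (sym_product ?X n) \<longleftrightarrow> ?e \<in># M"
      if "rel_mset (\<in>) M N" for M
      using that by (fastforce simp: topspace_sym_product dest: multi_member_split)
    then have "?f N - add_mset ?e ` topspace (sym_product ?X n) =
        {M. rel_mset (\<in>) M N \<and> ?e \<notin># M}" by auto
    then show ?thesis by (simp add: matched_without_point)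
  qed
  have "(\<lambda>s. s - add_mset ?e ` topspace (sym_product ?X n)) ` sym_strata ?X ?T (Suc n) - {{}} =
      ?f ` ?W ?R (Suc n)"
  proof (intro equalityI subsetI)
    fix s
    assume "s \<in> (\<lambda>s. s - add_mset ?e ` topspace (sym_product ?X n)) ` sym_strata ?X ?T (Suc n) - {{}}"
    then obtain N where N: "N \<in> ?W ?T (Suc n)"
      and s': "s = ?f N - add_mset ?e ` topspace (sym_product ?X n)" "s \<noteq> {}"
      unfolding sym_strata_eq[OF P] by blast
    have s: "s = ?f (image_mset (\<lambda>A. A - {?e}) N)"
      unfolding s'(1) by (rule minus[OF N])
    have "{} \<notin># image_mset (\<lambda>A. A - {?e}) N"
      using s s'(2) matched_empty_piece by metis
    then have "image_mset (\<lambda>A. A - {?e}) N \<in> ?W ?R (Suc n)" using N by auto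
    then show "s \<in> ?f ` ?W ?R (Suc n)" unfolding s by (rule imageI)
  next
    fix s assume "s \<in> ?f ` ?W ?R (Suc n)"
    then obtain N0 where N0: "size N0 = Suc n" "set_mset N0 \<subseteq> ?R" "s = ?f N0" by blast
    then have "set_mset N0 \<subseteq> (\<lambda>A. A - {?e}) ` ?T" by blast
    then obtain N where N: "set_mset N \<subseteq> ?T" "N0 = image_mset (\<lambda>A. A - {?e}) N"
      by (rule multiset_in_imageE)
    have W: "N \<in> ?W ?T (Suc n)" using N N0(1) by auto
    have "{} \<notin># N0" using N0(2) by auto
    then have "s \<noteq> {}" using ex_matched_points N0(3) by blast
    moreover have "s = ?f N - add_mset ?e ` topspace (sym_product ?X n)"
      using minus[OF W] N(2) N0(3) by simp
    ultimately show
      "s \<in> (\<lambda>s. s - add_mset ?e ` topspace (sym_product ?X n)) ` sym_strata ?X ?T (Suc n) - {{}}"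
      using W unfolding sym_strata_eq[OF P] by blast
  qed
  moreover have "(\<lambda>t. add_mset ?e ` t) ` sym_strata ?X ?T' n = ?f ` add_mset {?e} ` ?W ?T' n"
    by (simp add: sym_strata_eq[OF partition_on_underlined_Str[OF P e]] image_image
        matched_add_singleton)
  moreover have "?W ?T' (Suc n) = ?W ?R (Suc n) \<union> add_mset {?e} ` ?W ?T' n"
  proof (intro equalityI subsetI)
    fix N assume N: "N \<in> ?W ?T' (Suc n)"
    show "N \<in> ?W ?R (Suc n) \<union> add_mset {?e} ` ?W ?T' n"
    proof (cases "{?e} \<in># N")
      case True
      then obtain N' where "N = add_mset {?e} N'" by (rule mset_add)
      then show ?thesis using N by auto
    next
      case False
      then have "set_mset N \<subseteq> ?R" using N unfolding T' by auto
      then show ?thesis using N by auto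
    qed
  qed (auto simp: T')
  ultimately show ?case
    by (simp only: underlined_sym_strata.simps Suc.IH image_Un
        sym_strata_eq[OF partition_on_underlined_Str[OF P e]])
qed

theorem theorem11:
  fixes S :: "cline stability" and M :: "complex stability" and n :: nat
  shows
    "(stability_theory S \<longrightarrow>
        digraph_iso
          (with_proj (Adj (sym_product (ambient S) n) (sym_strata (ambient S) (Str S) n)))
          (with_proj (digraph_sym_power (Adj (ambient S) (Str S)) n)) \<and>
        digraph_iso
          (with_proj (Adj (sym_product (ambient S) n) (underlined_sym_strata S n)))
          (with_proj (digraph_sym_power (Adj (ambient S) (underlined_Str S)) n))) \<and>
     (monic_stability_theory M \<longrightarrow>
        digraph_iso
          (with_proj (Adj (sym_product (ambient M) n) (sym_strata (ambient M) (Str M) n)))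
          (with_proj (digraph_sym_power (Adj (ambient M) (Str M)) n)) \<and>
        digraph_iso
          (with_proj (Adj (sym_product (ambient M) n) (underlined_sym_strata M n)))
          (with_proj (digraph_sym_power (Adj (ambient M) (underlined_Str M)) n)))"
proof (intro conjI impI)
  assume S: "stability_theory S"
  then have "stable_locus S \<subseteq> topspace (ambient S)"
    by (simp add: stability_theory_def semialgebraic_CP1_def)
  then have P: "partition_on (topspace (ambient S)) (Str S)"
    by (rule partition_on_Str)
  have "topspace (ambient S) = cline ` (UNIV - {(0, 0)})"
    using S by (simp add: stability_theory_def CP1_def)
  moreover have "basepoint S = cline (1, 0)"
    using S by (simp add: stability_theory_def CP1_infinity_def)
  ultimately have e: "basepoint S \<in> topspace (ambient S)" by simp
  show "digraph_iso
      (with_proj (Adj (sym_product (ambient S) n) (sym_strata (ambient S) (Str S) n)))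
      (with_proj (digraph_sym_power (Adj (ambient S) (Str S)) n))"
    by (rule digraph_iso_Adj_sym_strata[OF P])
  show "digraph_iso
      (with_proj (Adj (sym_product (ambient S) n) (underlined_sym_strata S n)))
      (with_proj (digraph_sym_power (Adj (ambient S) (underlined_Str S)) n))"
    unfolding underlined_sym_strata_eq_sym_strata[OF P e]
    by (rule digraph_iso_Adj_sym_strata[OF partition_on_underlined_Str[OF P e]])
next
  assume M: "monic_stability_theory M"
  then have e: "basepoint M \<in> topspace (ambient M)"
    and "stable_locus M \<subseteq> topspace (ambient M)"
    by (simp_all add: monic_stability_theory_def)
  then have P: "partition_on (topspace (ambient M)) (Str M)"
    by (intro partition_on_Str)
  show "digraph_iso
      (with_proj (Adj (sym_product (ambient M) n) (sym_strata (ambient M) (Str M) n)))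
      (with_proj (digraph_sym_power (Adj (ambient M) (Str M)) n))"
    by (rule digraph_iso_Adj_sym_strata[OF P])
  show "digraph_iso
      (with_proj (Adj (sym_product (ambient M) n) (underlined_sym_strata M n)))
      (with_proj (digraph_sym_power (Adj (ambient M) (underlined_Str M)) n))"
    unfolding underlined_sym_strata_eq_sym_strata[OF P e]
    by (rule digraph_iso_Adj_sym_strata[OF partition_on_underlined_Str[OF P e]])
qed

end
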